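(* For $n\ge1$ let $L_n$ be the linear hexagonal chain with vertices $p_0,\dots,p_n,q_0,\dots,q_n,u_0,\dots,u_{n-1},v_0,\dots,v_{n-1}$ and edges $p_iq_i$ $(0\le i\le n)$ and $p_iu_i,\ u_ip_{i+1},\ q_iv_i,\ v_iq_{i+1}$ $(0\le i\le n-1)$, and let $\alpha=3-2\sqrt2$. Then $$K\!f(L_n)=\frac{(1+2n)\big(21-6\sqrt2+2(8+9\sqrt2)n-\alpha^{2n+2}(21+6\sqrt2+2(8-9\sqrt2)n)\big)}{12(1-\alpha^{2n+2})}+\frac43(1+2n)n^2.$$
   Context: The Kirchhoff index of a connected graph $G$ is $K\!f(G)=\sum_{\{u,v\}\subseteq V(G)}r_G(u,v)$, summed over unordered pairs of distinct vertices, where $r_G(u,v)$ is the effective resistance between $u$ and $v$ when each edge is a unit resistor. *)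

theory Defs
  imports Complex_Main
begin

text \<open>A graph is given by its vertex set \<open>V\<close> and its set \<open>E\<close> of edges, an edge being the
  two-element set of its end points.\<close>

text \<open>\<open>\<phi>\<close> is the electric potential when every edge is a unit resistor and a unit current enters
  the network at \<open>u\<close> and leaves it at \<open>v\<close>. By Ohm's law the current from \<open>x\<close> to \<open>y\<close> along an edge
  is \<open>\<phi> x - \<phi> y\<close>, so the equation is Kirchhoff's current law at \<open>x\<close>.\<close>

definition unit_current_potential ::
  "'a set \<Rightarrow> 'a set set \<Rightarrow> 'a \<Rightarrow> 'a \<Rightarrow> ('a \<Rightarrow> real) \<Rightarrow> bool" where
  "unit_current_potential V E u v \<phi> \<longleftrightarrow>
     (\<forall>x\<in>V. (\<Sum>y\<in>{y\<in>V. {x, y} \<in> E}. \<phi> x - \<phi> y) =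
        (if x = u then 1 else 0) - (if x = v then 1 else 0))"

text \<open>In a finite connected graph such a potential exists and is unique up to an additive constant,
  so the potential difference is well defined.\<close>

definition effective_resistance :: "'a set \<Rightarrow> 'a set set \<Rightarrow> 'a \<Rightarrow> 'a \<Rightarrow> real" where
  "effective_resistance V E u v =
     (THE r. \<exists>\<phi>. unit_current_potential V E u v \<phi> \<and> r = \<phi> u - \<phi> v)"

lemma effective_resistance_commute:
  "effective_resistance V E u v = effective_resistance V E v u"
proof -
  have flip: "unit_current_potential V E b a (\<lambda>x. - \<phi> x)"
    if "unit_current_potential V E a b \<phi>" for a b \<phi>
    unfolding unit_current_potential_def
  proof
    fix x assume "x \<in> V"
    have "(\<Sum>y\<in>{y\<in>V. {x, y} \<in> E}. - \<phi> x - - \<phi> y) = - (\<Sum>y\<in>{y\<in>V. {x, y} \<in> E}. \<phi> x - \<phi> y)"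
      by (simp flip: sum_negf)
    then show "(\<Sum>y\<in>{y\<in>V. {x, y} \<in> E}. - \<phi> x - - \<phi> y) =
        (if x = b then 1 else 0) - (if x = a then 1 else 0)"
      using that \<open>x \<in> V\<close> by (auto simp: unit_current_potential_def)
  qed
  have imp: "\<exists>\<phi>. unit_current_potential V E b a \<phi> \<and> r = \<phi> b - \<phi> a"
    if "\<exists>\<phi>. unit_current_potential V E a b \<phi> \<and> r = \<phi> a - \<phi> b" for a b r
  proof -
    from that obtain \<phi> where "unit_current_potential V E a b \<phi>" "r = \<phi> a - \<phi> b" by blast
    with flip[of a b \<phi>] show ?thesis by (intro exI[of _ "\<lambda>x. - \<phi> x"]) simp
  qed
  have "(\<exists>\<phi>. unit_current_potential V E u v \<phi> \<and> r = \<phi> u - \<phi> v) \<longleftrightarrow>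
      (\<exists>\<phi>. unit_current_potential V E v u \<phi> \<and> r = \<phi> v - \<phi> u)" for r
    using imp[of u v r] imp[of v u r] by blast
  then show ?thesis
    unfolding effective_resistance_def by presburger
qed

text \<open>The definite description turns the symmetric function \<open>effective_resistance V E\<close> into a function
  of the unordered pair \<open>e\<close>; see \<open>pair_resistance_insert\<close>.\<close>

definition pair_resistance :: "'a set \<Rightarrow> 'a set set \<Rightarrow> 'a set \<Rightarrow> real" where
  "pair_resistance V E e =
     (THE r. \<forall>u v. e = {u, v} \<longrightarrow> r = effective_resistance V E u v)"

lemma pair_resistance_insert [simp]:
  "pair_resistance V E {u, v} = effective_resistance V E u v"
  unfolding pair_resistance_def
proof (rule the_equality)
  show "\<forall>a b. {u, v} = {a, b} \<longrightarrow> effective_resistance V E u v = effective_resistance V E a b"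
    by (auto simp: doubleton_eq_iff effective_resistance_commute)
qed blast

definition Kirchhoff_index :: "'a set \<Rightarrow> 'a set set \<Rightarrow> real" where
  "Kirchhoff_index V E = (\<Sum>e\<in>{e. e \<subseteq> V \<and> card e = 2}. pair_resistance V E e)"

datatype hex_vertex = P nat | Q nat | U nat | V nat

definition hex_chain_verts :: "nat \<Rightarrow> hex_vertex set" where
  "hex_chain_verts n = P ` {0..n} \<union> Q ` {0..n} \<union> U ` {0..<n} \<union> V ` {0..<n}"

definition hex_chain_edges :: "nat \<Rightarrow> hex_vertex set set" where
  "hex_chain_edges n =
     {{P i, Q i} | i. i \<le> n} \<union>
     {{P i, U i} | i. i < n} \<union> {{U i, P (i + 1)} | i. i < n} \<union>
     {{Q i, V i} | i. i < n} \<union> {{V i, Q (i + 1)} | i. i < n}"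

end

theory Submission
  imports Defs
begin

text \<open>Suppose that \<open>L G(\<cdot>, y) = \<delta>\<^sub>y - c\<close> for the Laplacian \<open>L\<close> of a graph with \<open>N\<close> vertices, where \<open>c\<close> does
  not depend on \<open>y\<close>. Then \<open>G(\<cdot>, u) - G(\<cdot>, v)\<close> is a unit current potential from
  \<open>u\<close> to \<open>v\<close>, and summing the resistances gives the Kirchhoff index \<open>N tr G - \<Sum>\<^bsub>x,y\<^esub> G(x, y)\<close>. The
  hexagonal chain consists of two copies of the path \<open>0, \<dots>, 2n\<close> joined by rungs at the even positions.
  Under the exchange of the two copies, \<open>L\<close> splits into the Laplacian of the path, for which
  \<open>- \<bar>i - j\<bar> / 2\<close> can serve as \<open>G\<close>, and the same operator with potential \<open>2\<close> at the even positions. The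
  Green function of the latter is \<open>f (min i j) f (2n - max i j) / W\<close>, where \<open>f\<close> is the solution of the
  homogeneous equation that satisfies the boundary condition at \<open>0\<close> and \<open>W\<close> is the Wronskian.\<close>

section \<open>Kirchhoff index from a Green function\<close>

definition laplacian :: "'a set \<Rightarrow> 'a set set \<Rightarrow> ('a \<Rightarrow> real) \<Rightarrow> 'a \<Rightarrow> real" where
  "laplacian X E \<phi> x = (\<Sum>y\<in>{y\<in>X. {x, y} \<in> E}. \<phi> x - \<phi> y)"

lemma laplacian_diff: "laplacian X E (\<lambda>x. f x - g x) x = laplacian X E f x - laplacian X E g x"
  unfolding laplacian_def by (simp flip: sum_subtractf add: algebra_simps)

lemma unit_current_potential_iff_laplacian:
  "unit_current_potential X E u v \<phi> \<longleftrightarrow>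
     (\<forall>x\<in>X. laplacian X E \<phi> x = (if x = u then 1 else 0) - (if x = v then 1 else 0))"
  by (simp add: unit_current_potential_def laplacian_def)

text \<open>The terms \<open>f x * g x\<close> cancel; exchanging the summation variables matches
  the others, as edges are unordered.\<close>

lemma laplacian_self_adjoint:
  assumes "finite X"
  shows "(\<Sum>x\<in>X. f x * laplacian X E g x) = (\<Sum>x\<in>X. laplacian X E f x * g x)"
proof -
  have L: "laplacian X E h x = (\<Sum>y\<in>X. if {x, y} \<in> E then h x - h y else 0)" for h x
    unfolding laplacian_def using assms by (simp add: sum.inter_filter)
  have "(\<Sum>x\<in>X. f x * laplacian X E g x) - (\<Sum>x\<in>X. laplacian X E f x * g x) =
      (\<Sum>x\<in>X. \<Sum>y\<in>X. if {x, y} \<in> E then f y * g x else 0)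
        - (\<Sum>x\<in>X. \<Sum>y\<in>X. if {x, y} \<in> E then f x * g y else 0)"
    unfolding L sum_distrib_left sum_distrib_right sum_subtractf [symmetric]
    by (intro sum.cong refl) (auto simp: algebra_simps)
  also have "(\<Sum>x\<in>X. \<Sum>y\<in>X. if {x, y} \<in> E then f y * g x else 0) =
      (\<Sum>x\<in>X. \<Sum>y\<in>X. if {x, y} \<in> E then f x * g y else 0)"
    by (subst sum.swap) (simp add: insert_commute)
  finally show ?thesis by simp
qed

text \<open>A new point \<open>a\<close> contributes the pairs \<open>{a, x}\<close>, which the
  double sum meets once in the row and once in the column of \<open>a\<close>.\<close>

lemma sum_card_2_subsets:
  fixes f :: "'a set \<Rightarrow> 'b::comm_semiring_1"
  assumes "finite A"
  shows "2 * (\<Sum>e\<in>{e. e \<subseteq> A \<and> card e = 2}. f e) =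
    (\<Sum>x\<in>A. \<Sum>y\<in>A. if x = y then 0 else f {x, y})"
  using assms
proof (induction A)
  case empty
  have "{e :: 'a set. e \<subseteq> {} \<and> card e = 2} = {}" by auto
  then show ?case by (simp only: sum.empty mult_zero_right)
next
  case (insert a A)
  have split: "{e. e \<subseteq> insert a A \<and> card e = 2} =
      {e. e \<subseteq> A \<and> card e = 2} \<union> (\<lambda>x. {a, x}) ` A" (is "?L = ?R")
  proof
    show "?L \<subseteq> ?R"
    proof
      fix e assume "e \<in> ?L"
      then obtain u v where "e = {u, v}" "u \<noteq> v" "u \<in> insert a A" "v \<in> insert a A"
        by (auto simp: card_2_iff)
      then show "e \<in> ?R"
        by (auto simp: insert_commute)
    qed
    show "?R \<subseteq> ?L"
      using insert.hyps by (auto simp: card_insert_if)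
  qed
  have disj: "{e. e \<subseteq> A \<and> card e = 2} \<inter> (\<lambda>x. {a, x}) ` A = {}"
    using insert.hyps by auto
  have inj: "inj_on (\<lambda>x. {a, x}) A"
    using insert.hyps by (auto simp: inj_on_def doubleton_eq_iff)
  have *: "(\<Sum>e\<in>{e. e \<subseteq> insert a A \<and> card e = 2}. f e) =
      (\<Sum>e\<in>{e. e \<subseteq> A \<and> card e = 2}. f e) + (\<Sum>x\<in>A. f {a, x})"
    unfolding split using insert.hyps disj
    by (subst sum.union_disjoint) (auto simp: sum.reindex [OF inj] finite_subset)
  have row: "(\<Sum>y\<in>A. if a = y then 0 else f {a, y}) = (\<Sum>y\<in>A. f {a, y})"
    "(\<Sum>x\<in>A. if x = a then 0 else f {x, a}) = (\<Sum>y\<in>A. f {a, y})"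
    using insert.hyps by (auto intro!: sum.cong simp: insert_commute)
  show ?case
    unfolding * distrib_left insert.IH
    using insert.hyps by (simp add: sum.distrib row mult_2 algebra_simps)
qed

text \<open>The pseudoinverse would have \<open>c\<close> constant. Allowing any \<open>c\<close>
  leaves room for a simpler \<open>G\<close>, since \<open>c\<close> cancels in differences of
  columns.\<close>

locale green_function =
  fixes X :: "'a set" and E :: "'a set set" and G :: "'a \<Rightarrow> 'a \<Rightarrow> real" and c :: "'a \<Rightarrow> real"
  assumes finite: "finite X"
    and laplacian_G: "\<And>x y. x \<in> X \<Longrightarrow> y \<in> X \<Longrightarrow>
      laplacian X E (\<lambda>z. G z y) x = (if x = y then 1 else 0) - c x"
begin

text \<open>Pairing a harmonic function with \<open>G(\<cdot>, y)\<close> recovers its value at \<open>y\<close> up to a constant, so no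
  connectivity assumption is needed.\<close>

lemma harmonic_const:
  assumes h: "\<And>x. x \<in> X \<Longrightarrow> laplacian X E h x = 0" and y: "y \<in> X"
  shows "h y = (\<Sum>x\<in>X. c x * h x)"
proof -
  have "0 = (\<Sum>x\<in>X. G x y * laplacian X E h x)"
    using h by simp
  also have "\<dots> = (\<Sum>x\<in>X. laplacian X E (\<lambda>z. G z y) x * h x)"
    by (rule laplacian_self_adjoint [OF finite])
  also have "\<dots> = (\<Sum>x\<in>X. (if x = y then h x else 0) - c x * h x)"
    using y by (intro sum.cong) (auto simp: laplacian_G algebra_simps)
  also have "\<dots> = h y - (\<Sum>x\<in>X. c x * h x)"
    using finite y by (simp add: sum_subtractf)
  finally show ?thesis by simp
qed

lemma effective_resistance_eq:
  assumes "u \<in> X" "v \<in> X"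
  shows "effective_resistance X E u v = G u u + G v v - G u v - G v u"
  unfolding effective_resistance_def
proof (rule the_equality)
  let ?\<psi> = "\<lambda>x. G x u - G x v"
  have \<psi>: "laplacian X E ?\<psi> x = (if x = u then 1 else 0) - (if x = v then 1 else 0)"
    if "x \<in> X" for x
    using that assms by (simp add: laplacian_diff laplacian_G)
  then show "\<exists>\<phi>. unit_current_potential X E u v \<phi> \<and> G u u + G v v - G u v - G v u = \<phi> u - \<phi> v"
    by (intro exI [of _ ?\<psi>]) (simp add: unit_current_potential_iff_laplacian)
  fix r assume "\<exists>\<phi>. unit_current_potential X E u v \<phi> \<and> r = \<phi> u - \<phi> v"
  then obtain \<phi> where \<phi>: "unit_current_potential X E u v \<phi>" and r: "r = \<phi> u - \<phi> v" by blast
  \<comment> \<open>Two potentials for the same current differ by a harmonic function, which takes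
    the same value at \<open>u\<close> and \<open>v\<close>.\<close>
  have "laplacian X E (\<lambda>x. \<phi> x - ?\<psi> x) x = 0" if "x \<in> X" for x
    unfolding laplacian_diff [of X E \<phi> ?\<psi>] using \<phi> \<psi> that
    by (simp add: unit_current_potential_iff_laplacian)
  from harmonic_const [OF this assms(1)] harmonic_const [OF this assms(2)]
  show "r = G u u + G v v - G u v - G v u"
    using r by simp
qed

lemma Kirchhoff_index_eq:
  "Kirchhoff_index X E = real (card X) * (\<Sum>x\<in>X. G x x) - (\<Sum>x\<in>X. \<Sum>y\<in>X. G x y)"
proof -
  \<comment> \<open>The summand vanishes for \<open>x = y\<close>, so the diagonal may be
    included.\<close>
  have "2 * Kirchhoff_index X E = (\<Sum>x\<in>X. \<Sum>y\<in>X. G x x + G y y - G x y - G y x)"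
    unfolding Kirchhoff_index_def sum_card_2_subsets [OF finite]
    by (intro sum.cong) (auto simp: effective_resistance_eq)
  also have "\<dots> = 2 * (real (card X) * (\<Sum>x\<in>X. G x x))
      - (\<Sum>x\<in>X. \<Sum>y\<in>X. G x y) - (\<Sum>x\<in>X. \<Sum>y\<in>X. G y x)"
    by (simp add: sum.distrib sum_subtractf sum_distrib_left)
  also have "(\<Sum>x\<in>X. \<Sum>y\<in>X. G y x) = (\<Sum>x\<in>X. \<Sum>y\<in>X. G x y)"
    by (rule sum.swap)
  finally show ?thesis by simp
qed

end

section \<open>The two Green functions on the path\<close>

definition path_laplacian :: "nat \<Rightarrow> (nat \<Rightarrow> real) \<Rightarrow> nat \<Rightarrow> real" where
  "path_laplacian m h i =
     (if i < m then h i - h (i + 1) else 0) + (if 0 < i then h i - h (i - 1) else 0)"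

text \<open>The slope drops from 1/2 to -1/2 at \<open>j\<close>; the missing neighbours at the two
  ends leave terms independent of \<open>j\<close>.\<close>

lemma path_laplacian_abs_diff:
  assumes "i \<le> m" "j \<le> m" "0 < m"
  shows "path_laplacian m (\<lambda>k. - \<bar>real k - real j\<bar> / 2) i =
    (if i = j then 1 else 0) - (if i = 0 then 1 / 2 else 0) - (if i = m then 1 / 2 else 0)"
  using assms by (auto simp: path_laplacian_def of_nat_diff abs_if field_simps)

text \<open>\<open>rung_sol (2 * k)\<close> is the Pell number with index \<open>2 * k + 1\<close>, and \<open>rung_sol (2 * k + 1)\<close> is half
  the Pell-Lucas number with index \<open>2 * k + 2\<close>.\<close>

definition rung_sol :: "nat \<Rightarrow> real" where
  "rung_sol i = ((sqrt 2 + 1) ^ (i + 1) + (sqrt 2 - 1) ^ (i + 1)) / (if even i then 2 * sqrt 2 else 2)"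

lemma sqrt_2_mult_sqrt_2: "sqrt 2 * (sqrt 2 * x) = 2 * x"
  by (simp flip: mult.assoc)

lemma rung_sol_0: "rung_sol 0 = 1"
  by (simp add: rung_sol_def)

text \<open>This is the equation at the end 0: degree 1 plus potential 2 gives the factor 3 over
  \<open>rung_sol 0\<close>.\<close>

lemma rung_sol_1: "rung_sol (Suc 0) = 3"
  by (simp add: rung_sol_def power2_eq_square algebra_simps)

text \<open>The numerators satisfy a recurrence with coefficient \<open>2 * sqrt 2\<close>, the sum
  of the two reciprocal bases; the alternating denominators turn it into 2 or 4.\<close>

lemma rung_sol_rec:
  "rung_sol (i + 2) = (if even i then 2 else 4) * rung_sol (i + 1) - rung_sol i"
  by (auto simp: rung_sol_def field_simps sqrt_2_mult_sqrt_2)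

lemma rung_sol_Suc:
  assumes "0 < i"
  shows "rung_sol (Suc i) = (if even i then 4 else 2) * rung_sol i - rung_sol (i - 1)"
  using rung_sol_rec [of "i - 1"] assms by (cases i) auto

text \<open>The value at \<open>m + 1\<close> is the one that the recurrence prescribes; the boundary condition at \<open>m\<close>
  makes the reflected solution take equal values at \<open>m\<close> and \<open>m + 1\<close>, which gives this form of the
  Wronskian.\<close>

definition rung_wronskian :: "nat \<Rightarrow> real" where
  "rung_wronskian m = rung_sol (Suc m) - rung_sol m"

text \<open>As \<open>m\<close> is even, \<open>i\<close> and \<open>m - i\<close> have equal
  parity, so the solution and its reflection obey the same recurrence and their Wronskian is
  constant. The induction runs down from \<open>i = m - 1\<close>.\<close>

lemma rung_wronskian_eq:
  assumes "even m" "i < m"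
  shows "rung_sol (Suc i) * rung_sol (m - i) - rung_sol i * rung_sol (m - Suc i) = rung_wronskian m"
  using assms(2)
proof (induction "m - i" arbitrary: i)
  case 0
  then show ?case by simp
next
  case (Suc d)
  show ?case
  proof (cases "Suc i = m")
    case True
    \<comment> \<open>Here the claim reads
      \<open>3 * rung_sol m - rung_sol (m - 1) = rung_wronskian m\<close>.\<close>
    have "odd i" using True assms(1) by auto
    with True rung_sol_rec [of i] rung_sol_Suc [of m] assms show ?thesis
      by (auto simp: rung_wronskian_def rung_sol_0 rung_sol_1 algebra_simps)
  next
    case False
    with Suc.prems have lt: "Suc i < m" by simp
    have IH: "rung_sol (Suc (Suc i)) * rung_sol (m - Suc i)
        - rung_sol (Suc i) * rung_sol (m - Suc (Suc i)) = rung_wronskian m"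
      using Suc.hyps(1) [of "Suc i"] Suc.hyps(2) lt by simp
    obtain k where k: "m = Suc (Suc i) + k" using lt by (metis less_iff_Suc_add add_Suc)
    have "even k \<longleftrightarrow> even i" using k assms(1) by auto
    then obtain a where i: "rung_sol (Suc (Suc i)) = a * rung_sol (Suc i) - rung_sol i"
      and k': "rung_sol (Suc (Suc k)) = a * rung_sol (Suc k) - rung_sol k"
      using rung_sol_rec [of i] rung_sol_rec [of k] by auto
    show ?thesis using IH unfolding i by (simp add: k k' algebra_simps)
  qed
qed

lemma rung_wronskian_closed_form:
  assumes "even m"
  shows "rung_wronskian m = ((sqrt 2 + 1) ^ (m + 2) - (sqrt 2 - 1) ^ (m + 2)) / (2 * sqrt 2)"
  using assms by (simp add: rung_wronskian_def rung_sol_def field_simps sqrt_2_mult_sqrt_2)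

lemma rung_wronskian_pos:
  assumes "even m"
  shows "0 < rung_wronskian m"
proof -
  have "(sqrt 2 - 1) ^ (m + 2) < (sqrt 2 + 1) ^ (m + 2)"
    by (rule power_strict_mono) auto
  then show ?thesis by (simp add: rung_wronskian_closed_form [OF assms])
qed

section \<open>Green function of the path with potential 2 at even positions\<close>

definition rung_green :: "nat \<Rightarrow> nat \<Rightarrow> nat \<Rightarrow> real" where
  "rung_green m i j = rung_sol (min i j) * rung_sol (m - max i j) / rung_wronskian m"

text \<open>Away from \<open>j\<close> only one factor varies with \<open>i\<close>, and it solves
  the homogeneous equation; at \<open>i = j\<close> the jump in slope is the Wronskian.\<close>

lemma path_laplacian_rung_green:
  assumes "even m" "0 < m" "i \<le> m" "j \<le> m"
  shows "path_laplacian m (\<lambda>k. rung_green m k j) i + (if even i then 2 * rung_green m i j else 0) =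
    (if i = j then 1 else 0)"
proof -
  define W where "W = rung_wronskian m"
  have W: "W > 0" using rung_wronskian_pos [OF assms(1)] by (simp add: W_def)
  have G: "rung_green m a b = rung_sol (min a b) * rung_sol (m - max a b) / W" for a b
    by (simp add: rung_green_def W_def)
  have scale: "path_laplacian m (\<lambda>k. h k / W) i = path_laplacian m h i / W" for h
    by (simp add: path_laplacian_def diff_divide_distrib add_divide_distrib)
  have "path_laplacian m (\<lambda>k. rung_sol (min k j) * rung_sol (m - max k j)) i
      + (if even i then 2 * (rung_sol (min i j) * rung_sol (m - max i j)) else 0) =
    (if i = j then W else 0)"
  proof -
    consider "i < j" | "i = j" | "j < i" by linarith
    then show ?thesis
    proof cases
      case 1
      show ?thesis
      proof (cases "i = 0")
        case True
        with 1 assms show ?thesis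
          by (simp add: path_laplacian_def rung_sol_0 rung_sol_1 min_def max_def)
      next
        case False
        have *: "rung_sol (i - 1) = (if even i then 4 else 2) * rung_sol i - rung_sol (Suc i)"
          using rung_sol_Suc [of i] False by simp
        have "min i j = i" "max i j = j" "min (Suc i) j = Suc i" "max (Suc i) j = j"
          "min (i - Suc 0) j = i - Suc 0" "max (i - Suc 0) j = j"
          using 1 by auto
        then show ?thesis
          using 1 False assms by (simp add: path_laplacian_def * [simplified] algebra_simps)
      qed
    next
      case 2
      show ?thesis
      proof (cases "i = m")
        case True
        have "rung_sol (m - 1) = 4 * rung_sol m - rung_sol (Suc m)"
          using rung_sol_Suc [of m] assms by simp
        with 2 True assms show ?thesis
          by (simp add: path_laplacian_def rung_sol_0 rung_sol_1 W_def rung_wronskian_def)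
      next
        case False
        then have "i < m" using assms by simp
        have *: "rung_sol (Suc i) * rung_sol (m - i) - rung_sol i * rung_sol (m - Suc i) = W"
          using rung_wronskian_eq [OF assms(1) \<open>i < m\<close>] by (simp add: W_def)
        show ?thesis
        proof (cases "i = 0")
          case True
          with 2 \<open>i < m\<close> * show ?thesis
            by (simp add: path_laplacian_def rung_sol_0 rung_sol_1)
        next
          case False
          have **: "rung_sol (i - 1) = (if even i then 4 else 2) * rung_sol i - rung_sol (Suc i)"
            using rung_sol_Suc [of i] False by simp
          have mm: "min (i - Suc 0) i = i - 1" "max (i - Suc 0) i = i" by auto
          show ?thesis
            using False \<open>i < m\<close> unfolding 2 [symmetric] * [symmetric]
            by (simp add: path_laplacian_def mm ** [simplified] algebra_simps)
        qed
      qed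
    next
      case 3
      then have mx: "min i j = j" "max i j = i" "min (Suc i) j = j" "max (Suc i) j = Suc i"
        "min (i - Suc 0) j = j" "max (i - Suc 0) j = i - Suc 0" by auto
      show ?thesis
      proof (cases "i = m")
        case True
        with 3 assms mx show ?thesis
          by (simp add: path_laplacian_def rung_sol_0 rung_sol_1)
      next
        case False
        define k where "k = m - Suc i"
        have k: "m - i = Suc k" "m - (i - 1) = Suc (Suc k)" "m - Suc i = k"
          using 3 False assms by (auto simp: k_def)
        \<comment> \<open>Since \<open>m\<close> is even, the mirror image \<open>Suc k\<close> of
          \<open>i\<close> has the parity of \<open>i\<close>.\<close>
        have "even k \<longleftrightarrow> odd i" using 3 False assms by (auto simp: k_def)
        then have *: "rung_sol (Suc (Suc k)) = (if even i then 4 else 2) * rung_sol (Suc k) - rung_sol k"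
          using rung_sol_rec [of k] by simp
        show ?thesis
          using 3 False assms k by (simp add: path_laplacian_def mx * algebra_simps)
      qed
    qed
  qed
  then show ?thesis
    using W unfolding G scale by (auto simp: field_simps)
qed

text \<open>With \<open>s = sqrt 2 + 1\<close> and \<open>t = sqrt 2 - 1\<close> we have \<open>s * t = 1\<close>, so each product expands to
  the constant \<open>s ^ (2 * n + 2) + t ^ (2 * n + 2)\<close> plus terms of a geometric series.\<close>

lemma sum_rung_sol_convolution:
  "(\<Sum>i\<le>2 * n. rung_sol i * rung_sol (2 * n - i)) =
    (3 * real n - 1) / 8 * ((sqrt 2 + 1) ^ (2 * n + 2) + (sqrt 2 - 1) ^ (2 * n + 2))
      + 7 / (16 * sqrt 2) * ((sqrt 2 + 1) ^ (2 * n + 2) - (sqrt 2 - 1) ^ (2 * n + 2))"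
proof -
  define \<beta> \<alpha> where "\<beta> = 3 + 2 * sqrt 2" and "\<alpha> = 3 - 2 * sqrt 2"
  have \<beta>: "(sqrt 2 + 1) ^ (2 * k) = \<beta> ^ k" and \<alpha>: "(sqrt 2 - 1) ^ (2 * k) = \<alpha> ^ k" for k
  proof -
    have "(sqrt 2 + 1)\<^sup>2 = \<beta>" "(sqrt 2 - 1)\<^sup>2 = \<alpha>"
      by (simp_all add: \<beta>_def \<alpha>_def power2_eq_square algebra_simps)
    then show "(sqrt 2 + 1) ^ (2 * k) = \<beta> ^ k" "(sqrt 2 - 1) ^ (2 * k) = \<alpha> ^ k"
      by (simp_all only: power_mult)
  qed
  have \<alpha>\<beta>: "\<alpha> * \<beta> = 1" and \<beta>\<alpha>: "\<beta> - \<alpha> = 4 * sqrt 2"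
    unfolding \<beta>_def \<alpha>_def by (simp_all add: algebra_simps)
  have ev: "rung_sol (2 * k) = ((sqrt 2 + 1) * \<beta> ^ k + (sqrt 2 - 1) * \<alpha> ^ k) / (2 * sqrt 2)" for k
    by (simp add: rung_sol_def flip: \<alpha> \<beta>)
  have od: "rung_sol (Suc (2 * k)) = (\<beta> ^ Suc k + \<alpha> ^ Suc k) / 2" for k
    using \<beta> [of "Suc k"] \<alpha> [of "Suc k"] by (simp add: rung_sol_def)
  have pow: "\<beta> ^ k * \<beta> ^ (m - k) = \<beta> ^ m" "\<alpha> ^ k * \<alpha> ^ (m - k) = \<alpha> ^ m" if "k \<le> m" for k m
    using that by (simp_all flip: power_add)
  have geo: "(\<Sum>k<m. \<beta> ^ k * \<alpha> ^ (m - Suc k)) = (\<beta> ^ m - \<alpha> ^ m) / (4 * sqrt 2)"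
    "(\<Sum>k<m. \<alpha> ^ k * \<beta> ^ (m - Suc k)) = (\<beta> ^ m - \<alpha> ^ m) / (4 * sqrt 2)" for m
    using power_diff_sumr2 [of \<beta> m \<alpha>] power_diff_sumr2 [of \<alpha> m \<beta>] \<beta>\<alpha>
    by (simp_all add: field_simps)
  \<comment> \<open>The denominators in \<open>rung_sol\<close> depend on parity, so even and odd
    positions are summed separately.\<close>
  have split: "(\<Sum>i\<le>2 * n. h i) = (\<Sum>k<Suc n. h (2 * k)) + (\<Sum>k<n. h (Suc (2 * k)))" for h :: "nat \<Rightarrow> real"
    by (induction n) simp_all
  have "rung_sol (2 * k) * rung_sol (2 * n - 2 * k) =
      (\<beta> ^ Suc n + \<alpha> ^ Suc n) / 8 + (\<beta> ^ k * \<alpha> ^ (Suc n - Suc k) + \<alpha> ^ k * \<beta> ^ (Suc n - Suc k)) / 8"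
    if "k < Suc n" for k
  proof -
    have n: "2 * n - 2 * k = 2 * (n - k)" by simp
    have "rung_sol (2 * k) * rung_sol (2 * n - 2 * k) =
       ((3 + 2 * sqrt 2) * (\<beta> ^ k * \<beta> ^ (n - k)) + (3 - 2 * sqrt 2) * (\<alpha> ^ k * \<alpha> ^ (n - k))
        + (\<beta> ^ k * \<alpha> ^ (n - k) + \<alpha> ^ k * \<beta> ^ (n - k))) / 8"
      unfolding n ev by (simp add: field_simps sqrt_2_mult_sqrt_2)
    with that show ?thesis
      by (simp add: pow \<beta>_def [symmetric] \<alpha>_def [symmetric] add_divide_distrib)
  qed
  then have even_part: "(\<Sum>k<Suc n. rung_sol (2 * k) * rung_sol (2 * n - 2 * k)) =
      (real n + 1) / 8 * (\<beta> ^ Suc n + \<alpha> ^ Suc n) + (\<beta> ^ Suc n - \<alpha> ^ Suc n) / (16 * sqrt 2)"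
    using geo [of "Suc n"]
    by (simp add: sum.distrib flip: sum_divide_distrib del: sum.lessThan_Suc power_Suc)
  have "rung_sol (Suc (2 * k)) * rung_sol (2 * n - Suc (2 * k)) =
      (\<beta> ^ Suc n + \<alpha> ^ Suc n) / 4 + (\<beta> ^ k * \<alpha> ^ (n - Suc k) + \<alpha> ^ k * \<beta> ^ (n - Suc k)) / 4"
    if "k < n" for k
  proof -
    have "2 * n - Suc (2 * k) = Suc (2 * (n - Suc k))" and n: "Suc n = Suc k + Suc (n - Suc k)"
      using that by auto
    moreover have "\<beta> ^ Suc n = \<beta> ^ Suc k * \<beta> ^ Suc (n - Suc k)"
      "\<alpha> ^ Suc n = \<alpha> ^ Suc k * \<alpha> ^ Suc (n - Suc k)"
      by (subst n, simp only: power_add)+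
    \<comment> \<open>Cancelling one \<open>\<alpha> * \<beta>\<close> lowers the mixed terms to
      total degree \<open>n - 1\<close>, the form needed for \<open>geo\<close>.\<close>
    moreover have "\<beta> ^ Suc k * \<alpha> ^ Suc j = \<beta> ^ k * \<alpha> ^ j" "\<alpha> ^ Suc k * \<beta> ^ Suc j = \<alpha> ^ k * \<beta> ^ j" for j
    proof -
      have "\<beta> ^ Suc k * \<alpha> ^ Suc j = (\<alpha> * \<beta>) * (\<beta> ^ k * \<alpha> ^ j)" by simp
      then show "\<beta> ^ Suc k * \<alpha> ^ Suc j = \<beta> ^ k * \<alpha> ^ j" unfolding \<alpha>\<beta> by simp
      have "\<alpha> ^ Suc k * \<beta> ^ Suc j = (\<alpha> * \<beta>) * (\<alpha> ^ k * \<beta> ^ j)" by simp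
      then show "\<alpha> ^ Suc k * \<beta> ^ Suc j = \<alpha> ^ k * \<beta> ^ j" unfolding \<alpha>\<beta> by simp
    qed
    ultimately show ?thesis
      by (simp add: od distrib_left distrib_right add_divide_distrib del: power_Suc)
  qed
  then have "(\<Sum>k<n. rung_sol (Suc (2 * k)) * rung_sol (2 * n - Suc (2 * k))) =
      real n / 4 * (\<beta> ^ Suc n + \<alpha> ^ Suc n) + (\<beta> ^ n - \<alpha> ^ n) / (8 * sqrt 2)"
    using geo [of n]
    by (simp add: sum.distrib flip: sum_divide_distrib del: power_Suc)
  \<comment> \<open>Brings the odd part to the exponent \<open>Suc n\<close> of the even
    part.\<close>
  moreover have "\<beta> ^ n - \<alpha> ^ n = 3 * (\<beta> ^ Suc n - \<alpha> ^ Suc n) - 2 * sqrt 2 * (\<beta> ^ Suc n + \<alpha> ^ Suc n)"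
  proof -
    have "\<beta> ^ n - \<alpha> ^ n = (\<alpha> * \<beta>) * (\<beta> ^ n - \<alpha> ^ n)" unfolding \<alpha>\<beta> by simp
    also have "\<dots> = \<alpha> * \<beta> ^ Suc n - \<beta> * \<alpha> ^ Suc n" by (simp add: algebra_simps)
    finally show ?thesis unfolding \<beta>_def \<alpha>_def by (simp add: algebra_simps)
  qed
  ultimately have "(\<Sum>i\<le>2 * n. rung_sol i * rung_sol (2 * n - i)) =
      (3 * real n - 1) / 8 * (\<beta> ^ Suc n + \<alpha> ^ Suc n) + 7 / (16 * sqrt 2) * (\<beta> ^ Suc n - \<alpha> ^ Suc n)"
    unfolding split even_part by (simp add: field_simps sqrt_2_mult_sqrt_2 del: power_Suc)
  then show ?thesis
    using \<beta> [of "Suc n"] \<alpha> [of "Suc n"] by simp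
qed

text \<open>Twice the Wiener index of the path.\<close>

lemma sum_abs_diff: "(\<Sum>i\<le>m. \<Sum>j\<le>m. \<bar>real i - real j\<bar>) = real m * (real m + 1) * (real m + 2) / 3"
proof (induction m)
  case (Suc m)
  have row: "(\<Sum>j\<le>m. \<bar>real (Suc m) - real j\<bar>) = (real m + 1) * (real m + 2) / 2"
  proof -
    have "(\<Sum>j\<le>m. \<bar>real (Suc m) - real j\<bar>) = (\<Sum>j\<le>m. real (Suc m) - real j)"
      by (intro sum.cong) auto
    also have "\<dots> = (real m + 1) * (real m + 1) - (\<Sum>j\<le>m. real j)"
      by (simp add: sum_subtractf algebra_simps)
    also have "(\<Sum>j\<le>m. real j) = real m * (real m + 1) / 2"
      by (induction m) (simp_all add: field_simps)
    finally show ?thesis by (simp add: field_simps)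
  qed
  have "(\<Sum>j\<le>m. \<bar>real j - real (Suc m)\<bar>) = (\<Sum>j\<le>m. \<bar>real (Suc m) - real j\<bar>)"
    by (simp add: abs_minus_commute)
  then show ?case
    unfolding sum.atMost_Suc sum.distrib row Suc.IH by (simp add: field_simps)
qed simp

section \<open>The hexagonal chain\<close>

text \<open>Side \<open>True\<close> is the path p_0, u_0, p_1, ..., p_n; side \<open>False\<close>
  is its mirror image.\<close>

definition chain_vertex :: "bool \<Rightarrow> nat \<Rightarrow> hex_vertex" where
  "chain_vertex s i = (if even i then if s then P else Q else if s then U else V) (i div 2)"

fun chain_pos :: "hex_vertex \<Rightarrow> nat" where
  "chain_pos (P i) = 2 * i"
| "chain_pos (Q i) = 2 * i"
| "chain_pos (U i) = 2 * i + 1"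
| "chain_pos (V i) = 2 * i + 1"

fun chain_side :: "hex_vertex \<Rightarrow> bool" where
  "chain_side (P i) = True"
| "chain_side (Q i) = False"
| "chain_side (U i) = True"
| "chain_side (V i) = False"

lemma chain_pos_vertex [simp]: "chain_pos (chain_vertex s i) = i"
  by (auto simp: chain_vertex_def)

lemma chain_side_vertex [simp]: "chain_side (chain_vertex s i) = s"
  by (auto simp: chain_vertex_def)

lemma chain_vertex_pos_side [simp]: "chain_vertex (chain_side x) (chain_pos x) = x"
  by (cases x) (auto simp: chain_vertex_def)

lemma chain_vertex_eq_iff [simp]: "chain_vertex s i = chain_vertex t j \<longleftrightarrow> s = t \<and> i = j"
proof
  assume "chain_vertex s i = chain_vertex t j"
  then have "chain_side (chain_vertex s i) = chain_side (chain_vertex t j)"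
    "chain_pos (chain_vertex s i) = chain_pos (chain_vertex t j)"
    by (simp_all only:)
  then show "s = t \<and> i = j" by simp
qed simp

lemma mem_hex_chain_verts_iff: "x \<in> hex_chain_verts n \<longleftrightarrow> chain_pos x \<le> 2 * n"
  by (cases x) (auto simp: hex_chain_verts_def)

lemma hex_chain_verts_eq: "hex_chain_verts n = case_prod chain_vertex ` (UNIV \<times> {..2 * n})"
proof
  show "hex_chain_verts n \<subseteq> case_prod chain_vertex ` (UNIV \<times> {..2 * n})"
  proof
    fix x assume "x \<in> hex_chain_verts n"
    then show "x \<in> case_prod chain_vertex ` (UNIV \<times> {..2 * n})"
      by (intro image_eqI [of _ _ "(chain_side x, chain_pos x)"])
        (simp_all add: mem_hex_chain_verts_iff)
  qed
qed (auto simp: mem_hex_chain_verts_iff)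

lemma inj_on_chain_vertex: "inj_on (case_prod chain_vertex) A"
  by (auto simp: inj_on_def)

lemma sum_hex_chain_verts:
  fixes f :: "hex_vertex \<Rightarrow> real"
  shows "(\<Sum>x\<in>hex_chain_verts n. f x) =
    (\<Sum>i\<le>2 * n. f (chain_vertex True i)) + (\<Sum>i\<le>2 * n. f (chain_vertex False i))"
proof -
  have "(\<Sum>x\<in>hex_chain_verts n. f x) = (\<Sum>(s, i)\<in>UNIV \<times> {..2 * n}. f (chain_vertex s i))"
    unfolding hex_chain_verts_eq sum.reindex [OF inj_on_chain_vertex]
    by (simp add: comp_def case_prod_beta)
  also have "\<dots> = (\<Sum>s\<in>UNIV. \<Sum>i\<le>2 * n. f (chain_vertex s i))"
    by (rule sum.cartesian_product [symmetric])
  finally show ?thesis by (simp add: UNIV_bool add.commute)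
qed

lemma card_hex_chain_verts: "card (hex_chain_verts n) = 2 * (2 * n + 1)"
  unfolding hex_chain_verts_eq card_image [OF inj_on_chain_vertex] by (simp add: card_cartesian_product)

lemma mem_hex_chain_edges_iff:
  "{x, y} \<in> hex_chain_edges n \<longleftrightarrow> chain_pos x \<le> 2 * n \<and> chain_pos y \<le> 2 * n \<and>
    (if chain_side x = chain_side y then chain_pos x = chain_pos y + 1 \<or> chain_pos y = chain_pos x + 1
     else chain_pos x = chain_pos y \<and> even (chain_pos x))"
  by (cases x; cases y) (auto simp: hex_chain_edges_def doubleton_eq_iff, presburger+)

text \<open>The rung term vanishes for \<open>\<phi>\<close> equal on both sides and doubles
  \<open>\<phi>\<close> when the sides have opposite signs; hence the potential 2.\<close>

lemma laplacian_hex_chain: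
  assumes "i \<le> 2 * n"
  shows "laplacian (hex_chain_verts n) (hex_chain_edges n) \<phi> (chain_vertex s i) =
    path_laplacian (2 * n) (\<lambda>k. \<phi> (chain_vertex s k)) i
      + (if even i then \<phi> (chain_vertex s i) - \<phi> (chain_vertex (\<not> s) i) else 0)"
proof -
  have "{y \<in> hex_chain_verts n. {chain_vertex s i, y} \<in> hex_chain_edges n} =
      (if i < 2 * n then {chain_vertex s (i + 1)} else {}) \<union>
      (if 0 < i then {chain_vertex s (i - 1)} else {}) \<union>
      (if even i then {chain_vertex (\<not> s) i} else {})" (is "?N = ?M")
  proof (rule set_eqI)
    fix y
    obtain t j where "y = chain_vertex t j" by (rule that) (rule chain_vertex_pos_side [symmetric])
    with assms show "y \<in> ?N \<longleftrightarrow> y \<in> ?M"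
      by (cases "t = s") (auto simp: mem_hex_chain_verts_iff mem_hex_chain_edges_iff)
  qed
  then show ?thesis
    unfolding laplacian_def by (auto simp: path_laplacian_def)
qed

text \<open>A point source is half the sum of its symmetric and antisymmetric extensions to both
  sides.\<close>

definition chain_green :: "nat \<Rightarrow> hex_vertex \<Rightarrow> hex_vertex \<Rightarrow> real" where
  "chain_green n x y = (- \<bar>real (chain_pos x) - real (chain_pos y)\<bar> / 2
     + (if chain_side x = chain_side y then 1 else - 1)
       * rung_green (2 * n) (chain_pos x) (chain_pos y)) / 2"

lemma path_laplacian_combine:
  "path_laplacian m (\<lambda>k. (g k + a * h k) / 2) i = (path_laplacian m g i + a * path_laplacian m h i) / 2"
  by (simp add: path_laplacian_def field_simps)

text \<open>Halving the end terms 1/2 of the path gives weight 1/4 at each of the four end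
  vertices.\<close>

lemma green_function_hex_chain:
  assumes "n \<ge> 1"
  shows "green_function (hex_chain_verts n) (hex_chain_edges n) (chain_green n)
    (\<lambda>x. (if chain_pos x = 0 then 1 / 4 else 0) + (if chain_pos x = 2 * n then 1 / 4 else 0))"
proof
  show "finite (hex_chain_verts n)" by (simp add: hex_chain_verts_def)
  fix x y assume xy: "x \<in> hex_chain_verts n" "y \<in> hex_chain_verts n"
  obtain s i where x: "x = chain_vertex s i" by (rule that) (rule chain_vertex_pos_side [symmetric])
  obtain t j where y: "y = chain_vertex t j" by (rule that) (rule chain_vertex_pos_side [symmetric])
  have ij: "i \<le> 2 * n" "j \<le> 2 * n" using xy by (simp_all add: x y mem_hex_chain_verts_iff)
  define a :: real where "a = (if s = t then 1 else - 1)"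
  have a': "(if (\<not> s) = t then 1 else - 1) = - a" by (auto simp: a_def)
  have "laplacian (hex_chain_verts n) (hex_chain_edges n) (\<lambda>z. chain_green n z y) x =
      (path_laplacian (2 * n) (\<lambda>k. - \<bar>real k - real j\<bar> / 2) i
       + a * (path_laplacian (2 * n) (\<lambda>k. rung_green (2 * n) k j) i
              + (if even i then 2 * rung_green (2 * n) i j else 0))) / 2"
    unfolding x y laplacian_hex_chain [OF ij(1)] chain_green_def chain_pos_vertex chain_side_vertex
      a' a_def [symmetric] path_laplacian_combine
    by (simp add: field_simps)
  also have "\<dots> = (if x = y then 1 else 0) - ((if chain_pos x = 0 then 1 / 4 else 0)
       + (if chain_pos x = 2 * n then 1 / 4 else 0))"
  proof -
    have "0 < 2 * n" using assms by simp
    then show ?thesis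
      unfolding path_laplacian_abs_diff [OF ij \<open>0 < 2 * n\<close>]
        path_laplacian_rung_green [OF dvd_triv_left \<open>0 < 2 * n\<close> ij]
      by (auto simp: x y a_def)
  qed
  finally show "laplacian (hex_chain_verts n) (hex_chain_edges n) (\<lambda>z. chain_green n z y) x =
      (if x = y then 1 else 0) - ((if chain_pos x = 0 then 1 / 4 else 0)
       + (if chain_pos x = 2 * n then 1 / 4 else 0))" .
qed

section \<open>Evaluation of the closed formula\<close>

theorem theorem5p1:
  fixes n :: nat and \<alpha> :: real
  assumes "n \<ge> 1"
    and "\<alpha> = 3 - 2 * sqrt 2"
  shows "Kirchhoff_index (hex_chain_verts n) (hex_chain_edges n) =
    (1 + 2 * real n) *
      (21 - 6 * sqrt 2 + 2 * (8 + 9 * sqrt 2) * real n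
        - \<alpha> ^ (2 * n + 2) * (21 + 6 * sqrt 2 + 2 * (8 - 9 * sqrt 2) * real n))
      / (12 * (1 - \<alpha> ^ (2 * n + 2)))
    + 4 / 3 * (1 + 2 * real n) * (real n)\<^sup>2"
proof -
  define X Y where "X = (sqrt 2 + 1) ^ (2 * n + 2)" and "Y = (sqrt 2 - 1) ^ (2 * n + 2)"
  have "X * Y = ((sqrt 2 + 1) * (sqrt 2 - 1)) ^ (2 * n + 2)"
    unfolding X_def Y_def by (rule power_mult_distrib [symmetric])
  also have "(sqrt 2 + 1) * (sqrt 2 - 1) = 1"
    by (simp add: algebra_simps)
  finally have XY: "X * Y = 1" by simp
  have YX: "Y < X"
    unfolding X_def Y_def by (rule power_strict_mono) auto
  have "\<alpha> = (sqrt 2 - 1)\<^sup>2"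
    by (simp add: assms(2) power2_eq_square algebra_simps)
  then have \<alpha>: "\<alpha> ^ (2 * n + 2) = Y * Y"
    unfolding Y_def by (simp only: power_mult [symmetric] power_add [symmetric] mult_2)
  interpret green_function "hex_chain_verts n" "hex_chain_edges n" "chain_green n"
    "\<lambda>x. (if chain_pos x = 0 then 1 / 4 else 0) + (if chain_pos x = 2 * n then 1 / 4 else 0)"
    by (rule green_function_hex_chain [OF assms(1)])
  have W: "rung_wronskian (2 * n) = (X - Y) / (2 * sqrt 2)"
    by (simp add: rung_wronskian_closed_form X_def Y_def)
  have trace: "(\<Sum>x\<in>hex_chain_verts n. chain_green n x x) =
      ((3 * real n - 1) / 8 * (X + Y) + 7 / (16 * sqrt 2) * (X - Y)) / rung_wronskian (2 * n)"
    unfolding X_def Y_def sum_rung_sol_convolution [symmetric]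
    by (simp add: sum_hex_chain_verts chain_green_def rung_green_def flip: sum_divide_distrib)
  \<comment> \<open>Both signs of the antisymmetric part occur equally often, so it cancels.\<close>
  have "(\<Sum>x\<in>hex_chain_verts n. \<Sum>y\<in>hex_chain_verts n. chain_green n x y) =
      - (\<Sum>i\<le>2 * n. \<Sum>j\<le>2 * n. \<bar>real i - real j\<bar>)"
    by (simp add: sum_hex_chain_verts chain_green_def flip: sum.distrib sum_negf)
  then have total: "(\<Sum>x\<in>hex_chain_verts n. \<Sum>y\<in>hex_chain_verts n. chain_green n x y) =
      - (2 * real n * (2 * real n + 1) * (2 * real n + 2) / 3)"
    by (simp add: sum_abs_diff)
  \<comment> \<open>Multiplying through by \<open>Y\<close> and using \<open>X * Y = 1\<close>
    leaves only \<open>Y * Y\<close>, the power of \<open>\<alpha>\<close> in the claim.\<close>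
  have ratio: "(X + Y) / (X - Y) = (1 + Y * Y) / (1 - Y * Y)"
  proof -
    have "Y \<noteq> 0" using XY by auto
    then have "(X + Y) / (X - Y) = ((X + Y) * Y) / ((X - Y) * Y)" by simp
    then show ?thesis using XY by (simp add: algebra_simps)
  qed
  have "1 - Y * Y = (X - Y) * Y" using XY by (simp add: algebra_simps)
  then have Y: "1 - Y * Y \<noteq> 0" using XY YX by auto
  have "Kirchhoff_index (hex_chain_verts n) (hex_chain_edges n) =
      2 * (2 * real n + 1) * ((3 * real n - 1) * sqrt 2 / 4 * ((X + Y) / (X - Y)) + 7 / 8)
      + 2 * real n * (2 * real n + 1) * (2 * real n + 2) / 3"
    unfolding Kirchhoff_index_eq trace W total card_hex_chain_verts
    using YX by (simp add: field_simps sqrt_2_mult_sqrt_2)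
  then show ?thesis
    unfolding ratio \<alpha> using Y by (simp add: divide_simps) (simp add: power2_eq_square algebra_simps)
qed

end
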